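(* Let $D_0$ be the six-vertex digraph that is the disjoint union (with no arcs between the parts) of a bidirected triangle (three vertices with all six ordered pairs of distinct vertices as arcs) and a directed path $x\to y\to z$ on three further vertices (with only the arcs $(x,y)$ and $(y,z)$). Then $D_0$ is a counterexample to both of the following statements: (i) (Woźniak's conjecture) every $n$-vertex digraph with at most $2n-4$ arcs is completable; (ii) (Zhang–Wei's repaired conjecture) every $n$-vertex digraph with at most $2n-3$ arcs is completable, except for the members of a previously known exceptional family, all of which have order four. Moreover, six is the first order at which (i) fails: for every $n\le 5$, every $n$-vertex digraph with at most $2n-4$ arcs is completable, whereas for $n=6$ this is false.
   Context: All digraphs are finite and loopless; opposite arcs $(u,v)$ and $(v,u)$ may both be present, but repeated arcs are not allowed. The complement $\overline D$ of a digraph $D$ has the same vertex set as $D$, and an ordered pair of distinct vertices is an arc of $\overline D$ exactly when it is not an arc of $D$. A digraph is self-complementary if it is isomorphic to its complement. An $n$-vertex digraph $D$ is completable if it is isomorphic to a spanning subdigraph of some self-complementary digraph of the same order $n$. The exceptional family in (ii) is a finite family of digraphs with four vertices and five arcs; only the fact that its members have order four matters, so being a counterexample to (ii) means being a noncompletable digraph of order $n\ne 4$ with at most $2n-3$ arcs. *)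

theory Defs
  imports "Graph_Theory.Graph_Theory"
begin

text \<open>
  Finite loopless digraphs without repeated arcs (opposite arcs allowed) are the library's
  \<^locale>\<open>pair_digraph\<close>; isomorphism and spanning subdigraphs are the library's
  \<^const>\<open>digraph_iso\<close> and \<^const>\<open>spanning\<close>, transferred along \<^const>\<open>with_proj\<close>.
\<close>

definition compl_digraph :: "'a pair_pre_digraph \<Rightarrow> 'a pair_pre_digraph" where
  "compl_digraph D =
    \<lparr> pverts = pverts D,
      parcs = {(u, v). u \<in> pverts D \<and> v \<in> pverts D \<and> u \<noteq> v \<and> (u, v) \<notin> parcs D} \<rparr>"

definition self_complementary :: "'a pair_pre_digraph \<Rightarrow> bool" where
  "self_complementary S \<longleftrightarrow>
    pair_digraph S \<and> digraph_iso (with_proj S) (with_proj (compl_digraph S))"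

text \<open>
  The self-complementary host lives on natural-number vertices, independently of the vertex
  type of \<open>D\<close>. As every finite digraph has an isomorphic copy on natural numbers and \<open>D\<close> is only
  embedded up to isomorphism, this is no restriction.
\<close>

definition completable :: "'a pair_pre_digraph \<Rightarrow> bool" where
  "completable D \<longleftrightarrow>
    (\<exists>(S :: nat pair_pre_digraph) (H :: nat pair_pre_digraph).
      self_complementary S \<and> card (pverts S) = card (pverts D) \<and>
      spanning (with_proj H) (with_proj S) \<and> digraph_iso (with_proj D) (with_proj H))"

text \<open>The bounds are taken over the integers, since \<open>2n - 4\<close> is negative for \<open>n < 2\<close>.\<close>

definition wozniak_counterexample :: "'a pair_pre_digraph \<Rightarrow> bool" where
  "wozniak_counterexample D \<longleftrightarrow>
    pair_digraph D \<and> int (card (parcs D)) \<le> 2 * int (card (pverts D)) - 4 \<and> \<not> completable D"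

text \<open>
  All exceptional digraphs of the repaired conjecture have order four, so a counterexample is
  required to have a different order.
\<close>

definition zhang_wei_counterexample :: "'a pair_pre_digraph \<Rightarrow> bool" where
  "zhang_wei_counterexample D \<longleftrightarrow>
    pair_digraph D \<and> card (pverts D) \<noteq> 4 \<and>
    int (card (parcs D)) \<le> 2 * int (card (pverts D)) - 3 \<and> \<not> completable D"

text \<open>Bidirected triangle on \<open>0, 1, 2\<close> together with the directed path \<open>3, 4, 5\<close>.\<close>

definition D0 :: "nat pair_pre_digraph" where
  "D0 = \<lparr> pverts = {0, 1, 2, 3, 4, 5},
          parcs = {(0, 1), (1, 0), (0, 2), (2, 0), (1, 2), (2, 1)} \<union> {(3, 4), (4, 5)} \<rparr>"

end

theory Submission
  imports Defs
begin

text \<open>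
  A digraph is completable iff some permutation \<open>p\<close> of its vertices admits a set of arcs that contains
  the given ones and contains exactly one of \<open>e\<close> and \<open>p e\<close> for every ordered pair \<open>e\<close>.
  For the six-vertex digraph, the image and the preimage of the triangle under \<open>p\<close> are independent
  3-sets; each of them must consist of the two ends of the path and one vertex of the triangle.
  Then \<open>p\<close> fixes the middle of the path, so the other five vertices would be split evenly into
  in-neighbours and non-in-neighbours of that vertex.

  Conversely, if \<open>p\<close> has order dividing four and at most one fixed point, every arc set without a
  conflict, i.e. without an arc \<open>e\<close> such that \<open>p e\<close> is an arc too, can be completed.
  For small orders it remains to find a conflict-free \<open>p\<close>; a branching search over
  the conflicts of candidate permutations exhausts the budget of arcs.
\<close>

section \<open>Library notions restated with vertex maps and sets of pairs\<close>

text \<open>A library isomorphism has separate maps for vertices, arcs, tails and heads. Under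
  \<open>with_proj\<close> tails and heads are \<open>fst\<close> and \<open>snd\<close>, which
  forces the arc map to be \<open>map_prod f f\<close> on the arcs.\<close>

lemma digraph_iso_with_proj_iff:
  "digraph_iso (with_proj G) (with_proj H) \<longleftrightarrow>
    pair_wf_digraph G \<and>
    (\<exists>f. inj_on f (pverts G) \<and> pverts H = f ` pverts G \<and> parcs H = map_prod f f ` parcs G)"
  (is "?L \<longleftrightarrow> ?R")
proof
  assume ?L
  then obtain h where iso: "pre_digraph.digraph_isomorphism (with_proj G) h"
    and H: "with_proj H = app_iso h (with_proj G)"
    by (auto simp: digraph_iso_def)
  have tl: "iso_tail h = fst" "iso_head h = snd"
    using arg_cong[OF H, of tail] arg_cong[OF H, of head] by simp_all
  have "iso_arcs h a = map_prod (iso_verts h) (iso_verts h) a" if "a \<in> parcs G" for a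
    using iso that by (auto simp: pre_digraph.digraph_isomorphism_def tl prod_eq_iff)
  then have "iso_arcs h ` parcs G = map_prod (iso_verts h) (iso_verts h) ` parcs G"
    by (rule image_cong[OF refl])
  moreover have "pverts H = iso_verts h ` pverts G" "parcs H = iso_arcs h ` parcs G"
    using arg_cong[OF H, of verts] arg_cong[OF H, of arcs] by simp_all
  ultimately show ?R
    using iso by (auto simp: pre_digraph.digraph_isomorphism_def wf_digraph_wp_iff)
next
  assume ?R
  then obtain f where wf: "pair_wf_digraph G" and inj: "inj_on f (pverts G)"
    and H: "pverts H = f ` pverts G" "parcs H = map_prod f f ` parcs G"
    by blast
  define h where "h = \<lparr>iso_verts = f, iso_arcs = map_prod f f, iso_head = snd, iso_tail = fst\<rparr>"
  have "parcs G \<subseteq> pverts G \<times> pverts G"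
    using wf by (auto dest: pair_wf_digraph.in_arcsD1 pair_wf_digraph.in_arcsD2)
  then have "inj_on (map_prod f f) (parcs G)"
    using map_prod_inj_on[OF inj inj] inj_on_subset by blast
  then have "pre_digraph.digraph_isomorphism (with_proj G) h"
    using wf inj by (simp add: pre_digraph.digraph_isomorphism_def h_def wf_digraph_wp_iff)
  moreover have "with_proj H = app_iso h (with_proj G)"
    by (simp add: app_iso_def with_proj_def h_def H)
  ultimately show ?L
    by (auto simp: digraph_iso_def)
qed

lemma spanning_with_proj_iff:
  "spanning (with_proj H) (with_proj S) \<longleftrightarrow>
    pair_wf_digraph H \<and> pair_wf_digraph S \<and> pverts H = pverts S \<and> parcs H \<subseteq> parcs S"
  by (auto simp: spanning_def subgraph_def wf_digraph_wp_iff)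

lemma pair_digraph_iff:
  "pair_digraph G \<longleftrightarrow>
    finite (pverts G) \<and> (\<forall>(u, v) \<in> parcs G. u \<in> pverts G \<and> v \<in> pverts G \<and> u \<noteq> v)"
  (is "_ \<longleftrightarrow> ?R")
proof
  assume "pair_digraph G"
  then interpret pair_digraph G .
  show ?R
    using pair_finite_verts by (auto dest: in_arcsD1 in_arcsD2 no_loops')
next
  assume R: ?R
  then have "parcs G \<subseteq> pverts G \<times> pverts G"
    by auto
  then have "finite (parcs G)"
    using R finite_subset by blast
  with R show "pair_digraph G"
    by unfold_locales auto
qed

lemma self_complementary_iff:
  "self_complementary S \<longleftrightarrow>
    pair_digraph S \<and>
    (\<exists>p. bij_betw p (pverts S) (pverts S) \<and>
      (\<forall>u \<in> pverts S. \<forall>v \<in> pverts S. u \<noteq> v \<longrightarrow> ((p u, p v) \<in> parcs S \<longleftrightarrow> (u, v) \<notin> parcs S)))"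
  (is "_ \<longleftrightarrow> _ \<and> ?R")
proof (cases "pair_digraph S")
  case True
  let ?V = "pverts S" and ?A = "parcs S"
  have wf: "pair_wf_digraph S"
    using True by (rule pair_digraph.pair_wf_digraph)
  have arcs: "u \<in> ?V \<and> v \<in> ?V \<and> u \<noteq> v" if "(u, v) \<in> ?A" for u v
    using True that by (auto simp: pair_digraph_iff)
  have "digraph_iso (with_proj S) (with_proj (compl_digraph S)) \<longleftrightarrow>
    (\<exists>p. bij_betw p ?V ?V \<and> parcs (compl_digraph S) = map_prod p p ` ?A)"
    by (auto simp: digraph_iso_with_proj_iff wf bij_betw_def compl_digraph_def)
  also have "\<dots> \<longleftrightarrow> ?R"
  proof (rule ex_cong1, rule conj_cong[OF refl])
    fix p assume bij: "bij_betw p ?V ?V"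
    then have inj: "p u = p v \<longleftrightarrow> u = v" if "u \<in> ?V" "v \<in> ?V" for u v
      using that by (auto simp: bij_betw_def inj_on_def)
    have in_V: "p u \<in> ?V" if "u \<in> ?V" for u
      using bij that by (auto simp: bij_betw_def)
    have surj: "\<exists>u \<in> ?V. v = p u" if "v \<in> ?V" for v
      using bij that by (auto simp: bij_betw_def)
    have image: "(p u, p v) \<in> map_prod p p ` ?A \<longleftrightarrow> (u, v) \<in> ?A" if "u \<in> ?V" "v \<in> ?V" for u v
      using that arcs inj by (force simp: image_iff)
    have compl: "(p u, p v) \<in> parcs (compl_digraph S) \<longleftrightarrow> u \<noteq> v \<and> (p u, p v) \<notin> ?A"
      if "u \<in> ?V" "v \<in> ?V" for u v
      using that by (auto simp: compl_digraph_def in_V inj)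
    have V: "map_prod p p ` (?V \<times> ?V) = ?V \<times> ?V"
      using bij by (intro map_prod_surj_on) (auto simp: bij_betw_def)
    have "parcs (compl_digraph S) \<subseteq> ?V \<times> ?V" "map_prod p p ` ?A \<subseteq> ?V \<times> ?V"
      using arcs in_V by (auto simp: compl_digraph_def)
    \<comment> \<open>Both sides lie in \<open>?V \<times> ?V\<close>, and every pair there is an
      image under \<open>p\<close>, so comparing them at the pairs \<open>(p u, p v)\<close> is
      enough.\<close>
    then have "parcs (compl_digraph S) = map_prod p p ` ?A \<longleftrightarrow>
      (\<forall>e \<in> map_prod p p ` (?V \<times> ?V). e \<in> parcs (compl_digraph S) \<longleftrightarrow> e \<in> map_prod p p ` ?A)"
      unfolding V by blast
    also have "\<dots> \<longleftrightarrow> (\<forall>u \<in> ?V. \<forall>v \<in> ?V.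
      (p u, p v) \<in> parcs (compl_digraph S) \<longleftrightarrow> (p u, p v) \<in> map_prod p p ` ?A)"
      by simp
    also have "\<dots> \<longleftrightarrow> (\<forall>u \<in> ?V. \<forall>v \<in> ?V. u \<noteq> v \<and> (p u, p v) \<notin> ?A \<longleftrightarrow> (u, v) \<in> ?A)"
      using image compl by auto
    also have "\<dots> \<longleftrightarrow> (\<forall>u \<in> ?V. \<forall>v \<in> ?V. u \<noteq> v \<longrightarrow> ((p u, p v) \<in> ?A \<longleftrightarrow> (u, v) \<notin> ?A))"
      using arcs by blast
    finally show "parcs (compl_digraph S) = map_prod p p ` ?A \<longleftrightarrow>
      (\<forall>u \<in> ?V. \<forall>v \<in> ?V. u \<noteq> v \<longrightarrow> ((p u, p v) \<in> ?A \<longleftrightarrow> (u, v) \<notin> ?A))" .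
  qed
  finally show ?thesis
    using True by (simp add: self_complementary_def)
qed (simp add: self_complementary_def)


text \<open>Conjugating by an injection \<open>f\<close> of the vertices into the naturals moves the
  self-complementing permutation between the host and \<open>D\<close>; \<open>A\<close> is the arc
  set of the host pulled back along \<open>f\<close>.\<close>

lemma completable_iff:
  assumes "pair_digraph D"
  shows "completable D \<longleftrightarrow>
    (\<exists>p A. bij_betw p (pverts D) (pverts D) \<and> parcs D \<subseteq> A \<and>
      (\<forall>u \<in> pverts D. \<forall>v \<in> pverts D. u \<noteq> v \<longrightarrow> ((p u, p v) \<in> A \<longleftrightarrow> (u, v) \<notin> A)))"
  (is "_ \<longleftrightarrow> ?R")
proof
  let ?V = "pverts D"
  assume "completable D"
  then obtain S H :: "nat pair_pre_digraph" and f where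
    S: "self_complementary S" and span: "spanning (with_proj H) (with_proj S)"
    and inj: "inj_on f ?V" and H: "pverts H = f ` ?V" "parcs H = map_prod f f ` parcs D"
    unfolding completable_def digraph_iso_with_proj_iff by blast
  from span have SH: "pverts S = f ` ?V" "parcs H \<subseteq> parcs S"
    by (auto simp: spanning_with_proj_iff H)
  from S obtain q where q: "bij_betw q (f ` ?V) (f ` ?V)"
    and flip: "\<And>x y. \<lbrakk>x \<in> f ` ?V; y \<in> f ` ?V; x \<noteq> y\<rbrakk> \<Longrightarrow>
      (q x, q y) \<in> parcs S \<longleftrightarrow> (x, y) \<notin> parcs S"
    unfolding self_complementary_iff SH by blast
  let ?g = "the_inv_into ?V f"
  have f: "bij_betw f ?V (f ` ?V)"
    using inj by (simp add: inj_on_imp_bij_betw)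
  have "bij_betw (?g \<circ> q \<circ> f) ?V ?V"
    using f q bij_betw_the_inv_into[OF f] by (blast intro: bij_betw_trans)
  moreover have "f ((?g \<circ> q \<circ> f) u) = q (f u)" if "u \<in> ?V" for u
  proof -
    have "q (f u) \<in> f ` ?V"
      using q that by (auto simp: bij_betw_def)
    then show ?thesis
      by (simp add: f_the_inv_into_f[OF inj])
  qed
  moreover have "f u \<noteq> f v" if "u \<in> ?V" "v \<in> ?V" "u \<noteq> v" for u v
    using inj that by (auto simp: inj_on_def)
  moreover have "parcs D \<subseteq> {(u, v). (f u, f v) \<in> parcs S}"
    using SH(2) by (auto simp: H)
  ultimately show ?R
    using flip
    by (intro exI[of _ "?g \<circ> q \<circ> f"] exI[of _ "{(u, v). (f u, f v) \<in> parcs S}"]) (auto simp del: o_apply)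
next
  let ?V = "pverts D"
  have arcs: "u \<in> ?V \<and> v \<in> ?V \<and> u \<noteq> v" if "(u, v) \<in> parcs D" for u v
    using assms that by (auto simp: pair_digraph_iff)
  assume ?R
  then obtain p A where p: "bij_betw p ?V ?V" and DA: "parcs D \<subseteq> A"
    and flip: "\<And>u v. \<lbrakk>u \<in> ?V; v \<in> ?V; u \<noteq> v\<rbrakk> \<Longrightarrow> (p u, p v) \<in> A \<longleftrightarrow> (u, v) \<notin> A"
    by blast
  have fin: "finite ?V"
    using assms by (simp add: pair_digraph_iff)
  then obtain f :: "'a \<Rightarrow> nat" where inj: "inj_on f ?V"
    by (metis finite_imp_inj_to_nat_seg)
  \<comment> \<open>The hypotheses leave \<open>A\<close> free on loops and outside the vertex set,
    so such pairs are removed before \<open>A\<close> becomes a digraph.\<close>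
  define B where "B = {(u, v) \<in> A. u \<in> ?V \<and> v \<in> ?V \<and> u \<noteq> v}"
  define S where "S = \<lparr>pverts = f ` ?V, parcs = map_prod f f ` B\<rparr>"
  define H where "H = \<lparr>pverts = f ` ?V, parcs = map_prod f f ` parcs D\<rparr>"
  have f_eq: "f u = f v \<longleftrightarrow> u = v" if "u \<in> ?V" "v \<in> ?V" for u v
    using inj that by (auto simp: inj_on_def)
  have S_arc: "(f u, f v) \<in> parcs S \<longleftrightarrow> u \<noteq> v \<and> (u, v) \<in> A" if "u \<in> ?V" "v \<in> ?V" for u v
    using that f_eq by (auto simp: S_def B_def image_iff Bex_def)
  have SV: "pverts S = f ` ?V"
    by (simp add: S_def)
  let ?g = "the_inv_into ?V f"
  have f: "bij_betw f ?V (f ` ?V)"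
    using inj by (simp add: inj_on_imp_bij_betw)
  have "pair_digraph S"
    using fin f_eq by (auto simp: pair_digraph_iff S_def B_def)
  moreover have "bij_betw (f \<circ> p \<circ> ?g) (f ` ?V) (f ` ?V)"
    using f p bij_betw_the_inv_into[OF f] by (blast intro: bij_betw_trans)
  moreover have "((f \<circ> p \<circ> ?g) x, (f \<circ> p \<circ> ?g) y) \<in> parcs S \<longleftrightarrow> (x, y) \<notin> parcs S"
    if "x \<in> f ` ?V" "y \<in> f ` ?V" "x \<noteq> y" for x y
  proof -
    from that obtain u v where uv: "u \<in> ?V" "v \<in> ?V" "x = f u" "y = f v" "u \<noteq> v"
      by blast
    then have "p u \<in> ?V" "p v \<in> ?V" "p u \<noteq> p v"
      using p by (auto simp: bij_betw_def inj_on_def)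
    with uv flip show ?thesis
      by (simp add: S_arc the_inv_into_f_f[OF inj])
  qed
  ultimately have "self_complementary S"
    unfolding self_complementary_iff SV by blast
  moreover have "card (pverts S) = card ?V"
    using inj by (simp add: S_def card_image)
  moreover have "spanning (with_proj H) (with_proj S)"
  proof -
    have "pair_wf_digraph H" "pair_wf_digraph S"
      using arcs by (auto simp: pair_wf_digraph_def H_def S_def B_def)
    moreover have "parcs D \<subseteq> B"
      using arcs DA by (auto simp: B_def)
    ultimately show ?thesis
      by (auto simp: spanning_with_proj_iff H_def S_def)
  qed
  moreover have "digraph_iso (with_proj D) (with_proj H)"
    using inj assms by (auto simp: digraph_iso_with_proj_iff H_def pair_digraph.pair_wf_digraph)
  ultimately show "completable D"
    unfolding completable_def by blast
qed

text \<open>With at most one fixed point of \<open>p\<close>, every pair of distinct vertices has an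
  orbit of length two or four under the induced map \<open>?t\<close>. Alternate members of an orbit
  are taken, and the absence of conflicts lets the arcs of \<open>D\<close> in it dictate which
  ones.\<close>

lemma completableI:
  assumes D: "pair_digraph D"
    and p_in: "\<And>u. u \<in> pverts D \<Longrightarrow> p u \<in> pverts D"
    and p4: "\<And>u. u \<in> pverts D \<Longrightarrow> p (p (p (p u))) = u"
    and fixed: "\<And>u v. \<lbrakk>u \<in> pverts D; v \<in> pverts D; p u = u; p v = v\<rbrakk> \<Longrightarrow> u = v"
    and free: "\<And>u v. (u, v) \<in> parcs D \<Longrightarrow> (p u, p v) \<notin> parcs D"
  shows "completable D"
proof -
  let ?V = "pverts D" and ?t = "\<lambda>(u, v). (p u, p v)"
  have fin: "finite (?V \<times> ?V)"
    using D by (simp add: pair_digraph_iff)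
  then obtain f :: "'a \<times> 'a \<Rightarrow> nat" where inj: "inj_on f (?V \<times> ?V)"
    by (metis finite_imp_inj_to_nat_seg)
  define k where "k e = min (f e) (f (?t (?t e)))" for e
  define P where "P e \<longleftrightarrow> e \<in> parcs D \<or> ?t (?t e) \<in> parcs D" for e
  \<comment> \<open>On orbits that do not meet the arcs of \<open>D\<close>, the smaller \<open>k\<close> decides between the two halves.\<close>
  define A where "A = {e. P e \<or> \<not> P (?t e) \<and> k e < k (?t e)}"
  have "bij_betw p ?V ?V"
    using p_in p4 by (intro bij_betw_byWitness[where f' = "\<lambda>u. p (p (p u))"]) auto
  moreover have "parcs D \<subseteq> A"
    by (auto simp: A_def P_def)
  moreover have "(p u, p v) \<in> A \<longleftrightarrow> (u, v) \<notin> A" if uv: "u \<in> ?V" "v \<in> ?V" "u \<noteq> v" for u v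
  proof -
    let ?e = "(u, v)"
    have V: "?e \<in> ?V \<times> ?V" "?t ?e \<in> ?V \<times> ?V" "?t (?t ?e) \<in> ?V \<times> ?V" "?t (?t (?t ?e)) \<in> ?V \<times> ?V"
      using uv p_in by auto
    have t4: "?t (?t (?t (?t ?e))) = ?e"
      using uv p4 by simp
    have "?t ?e \<noteq> ?e"
      using uv fixed by auto
    moreover from this have "?t (?t (?t ?e)) \<noteq> ?e"
      using t4 by metis
    moreover have "?t (?t ?e) \<noteq> ?t ?e" "?t (?t (?t ?e)) \<noteq> ?t (?t ?e)"
      using \<open>?t ?e \<noteq> ?e\<close> t4 by metis+
    \<comment> \<open>These are minima of the injective \<open>f\<close> over the two halves of an
      orbit, which are disjoint.\<close>
    ultimately have "k (?t ?e) \<noteq> k ?e"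
      using inj V by (auto simp: k_def min_def inj_on_eq_iff simp del: split_conv split: if_splits)
    moreover have "k (?t (?t ?e)) = k ?e"
      using t4 by (simp add: k_def min.commute)
    moreover have "P (?t (?t ?e)) = P ?e"
      using t4 by (auto simp: P_def)
    \<comment> \<open>Arcs of \<open>D\<close> from both halves of an orbit would include two with
      one the image of the other under \<open>?t\<close>.\<close>
    moreover have "\<not> (P ?e \<and> P (?t ?e))"
      using free t4 by (force simp: P_def)
    ultimately show ?thesis
      by (auto simp: A_def)
  qed
  ultimately show ?thesis
    unfolding completable_iff[OF D] by blast
qed

section \<open>The six-vertex digraph\<close>

lemma not_completable_D0: "\<not> completable D0"
proof
  define V :: "nat set" where "V = {0, 1, 2, 3, 4, 5}"
  have V: "pverts D0 = V"
    by (simp add: D0_def V_def)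
  have "pair_digraph D0"
    by (simp add: pair_digraph_iff D0_def)
  moreover assume "completable D0"
  ultimately obtain p A where p: "bij_betw p V V" and sub: "parcs D0 \<subseteq> A"
    and flip: "\<And>u v. \<lbrakk>u \<in> V; v \<in> V; u \<noteq> v\<rbrakk> \<Longrightarrow> (p u, p v) \<in> A \<longleftrightarrow> (u, v) \<notin> A"
    unfolding completable_iff[OF \<open>pair_digraph D0\<close>] V by blast
  define T :: "nat set" where "T = {0, 1, 2}"
  have T: "(u, v) \<in> A" if "u \<in> T" "v \<in> T" "u \<noteq> v" for u v
    using that sub by (auto simp: T_def D0_def)
  have path: "(3, 4) \<in> A" "(4, 5) \<in> A"
    using sub by (auto simp: D0_def)
  have p_in: "p u \<in> V" if "u \<in> V" for u
    using p that by (auto simp: bij_betw_def)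
  have p_eq: "p u = p v \<longleftrightarrow> u = v" if "u \<in> V" "v \<in> V" for u v
    using p that by (auto simp: bij_betw_def inj_on_def)
  have TV: "T \<subseteq> V"
    by (auto simp: T_def V_def)
  have indep: "4 \<notin> I \<and> 3 \<in> I \<and> 5 \<in> I"
    if "I \<subseteq> V" "card I = 3" and I: "\<And>u v. \<lbrakk>u \<in> I; v \<in> I; u \<noteq> v\<rbrakk> \<Longrightarrow> (u, v) \<notin> A" for I
  proof -
    have "u = v" if "u \<in> I \<inter> T" "v \<in> I \<inter> T" for u v
      using that T I by blast
    moreover have "finite (I \<inter> T)"
      by (simp add: T_def)
    ultimately have IT: "card (I \<inter> T) \<le> 1"
      by (metis One_nat_def card_le_Suc0_iff_eq)
    \<comment> \<open>In other words, \<open>I\<close> has at least two vertices on the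
      path.\<close>
    have small: "\<not> I \<subseteq> insert w T" for w
    proof
      assume "I \<subseteq> insert w T"
      then have "I \<subseteq> insert w (I \<inter> T)"
        by blast
      then have "card I \<le> card (insert w (I \<inter> T))"
        by (intro card_mono) (auto simp: T_def)
      also have "\<dots> \<le> Suc (card (I \<inter> T))"
        by (rule card_insert_le_m1) auto
      finally show False
        using IT \<open>card I = 3\<close> by simp
    qed
    \<comment> \<open>Otherwise \<open>I\<close> would also contain \<open>3\<close> or
      \<open>5\<close>, which is joined to \<open>4\<close> by an arc in \<open>A\<close>.\<close>
    have "4 \<notin> I"
      using small[of 4] \<open>I \<subseteq> V\<close> I path by (auto simp: V_def T_def)
    then show ?thesis
      using small[of 3] small[of 5] \<open>I \<subseteq> V\<close> by (auto simp: V_def T_def)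
  qed
  have cardT: "card T = 3"
    by (simp add: T_def)
  have im: "4 \<notin> p ` T \<and> 3 \<in> p ` T \<and> 5 \<in> p ` T"
  proof (rule indep)
    show "p ` T \<subseteq> V"
      using p_in TV by blast
    show "card (p ` T) = 3"
      using p TV cardT by (metis bij_betw_def card_image inj_on_subset)
    show "(u, v) \<notin> A" if "u \<in> p ` T" "v \<in> p ` T" "u \<noteq> v" for u v
      using that flip T TV by blast
  qed
  define R where "R = {u \<in> V. p u \<in> T}"
  have pR: "p ` R = T"
    using p TV by (auto simp: R_def bij_betw_def)
  have preim: "4 \<notin> R \<and> 3 \<in> R \<and> 5 \<in> R"
  proof (rule indep)
    show "R \<subseteq> V"
      by (auto simp: R_def)
    then show "card R = 3"
      using p pR cardT by (metis bij_betw_def card_image inj_on_subset)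
    show "(u, v) \<notin> A" if "u \<in> R" "v \<in> R" "u \<noteq> v" for u v
      using that flip T p_eq unfolding R_def by blast
  qed
  have "4 \<in> V"
    by (simp add: V_def)
  then obtain w where w: "w \<in> V" "p w = 4"
    using p by (metis bij_betw_def imageE)
  have "w = 4"
    using w im preim by (auto simp: V_def T_def R_def)
  then have p4: "p 4 = 4"
    using w by simp
  define W where "W = V - {4}"
  define N where "N = {u \<in> W. (u, 4) \<in> A}"
  have W: "bij_betw p W W"
    using bij_betw_DiffI[OF p, of "{4}" "{4}"] p4 \<open>4 \<in> V\<close> by (simp add: W_def bij_betw_def)
  have flip4: "(p u, 4) \<in> A \<longleftrightarrow> (u, 4) \<notin> A" if "u \<in> W" for u
    using that flip[of u 4] p4 \<open>4 \<in> V\<close> by (auto simp: W_def)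
  have "p ` N = W - N"
  proof (intro equalityI subsetI)
    fix v assume "v \<in> p ` N"
    then show "v \<in> W - N"
      using W flip4 by (auto simp: N_def bij_betw_def)
  next
    fix v assume v: "v \<in> W - N"
    then obtain u where "u \<in> W" "v = p u"
      using W by (auto simp: bij_betw_def)
    then show "v \<in> p ` N"
      using v flip4 by (auto simp: N_def)
  qed
  moreover have NW: "N \<subseteq> W" "finite W"
    by (auto simp: N_def W_def V_def)
  moreover have "card (p ` N) = card N"
    using W NW by (metis bij_betw_def card_image inj_on_subset)
  ultimately have "card W = 2 * card N"
    by (metis card_Diff_subset card_mono finite_subset le_add_diff_inverse mult_2)
  moreover have "card W = 5"
    by (simp add: W_def V_def)
  ultimately show False
    by presburger
qed

section \<open>Branching search over conflicts\<close>

text \<open>Applied to a set of arcs and a list of pairs \<open>(e, p e)\<close> for a permutation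
  \<open>p\<close>, this expresses that \<open>p\<close> has none of the listed conflicts.\<close>

definition avoids :: "'a set \<Rightarrow> ('a \<times> 'a) list \<Rightarrow> bool" where
  "avoids A C \<longleftrightarrow> (\<forall>(x, y) \<in> set C. \<not> (x \<in> A \<and> y \<in> A))"

text \<open>
  Here \<open>F\<close> lists elements known to lie in the unknown set, which has at most \<open>k\<close> further elements.
  If the set does not avoid the chosen list, it contains both components of one of its pairs.
\<close>

fun search :: "('a list \<Rightarrow> bool) \<Rightarrow> ('a list \<Rightarrow> ('a \<times> 'a) list option) \<Rightarrow> nat \<Rightarrow> 'a list \<Rightarrow> bool" where
  "search prune pick 0 F \<longleftrightarrow> prune F \<or> pick F \<noteq> None"
| "search prune pick (Suc k) F \<longleftrightarrow> prune F \<or>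
     (case pick F of None \<Rightarrow> False
      | Some C \<Rightarrow> \<forall>(x, y) \<in> set C.
          if x \<in> set F then search prune pick k (y # F)
          else if y \<in> set F then search prune pick k (x # F)
          else if k = 0 then True
          else search prune pick (k - 1) (x # y # F))"

text \<open>If \<open>A\<close> contains a conflict of the list chosen for \<open>F\<close>, at
  least one of its two elements is new, because \<open>F\<close> avoids that list. Each new element
  costs one unit of the budget \<open>k\<close>, so the induction is on \<open>k\<close>.
  \<open>prune\<close> may cut only branches that no subset of \<open>A\<close> reaches.\<close>

lemma search_sound:
  assumes "search prune pick k F"
    and "set F \<subseteq> A" and "finite A" and "card A \<le> card (set F) + k"
    and pick: "\<And>F. pick F = find (avoids (set F)) Cs"
    and prune: "\<And>F. set F \<subseteq> A \<Longrightarrow> \<not> prune F"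
    and irrefl: "\<forall>C \<in> set Cs. \<forall>(x, y) \<in> set C. x \<noteq> y"
  shows "\<exists>C \<in> set Cs. avoids A C"
  using assms(1-4)
proof (induction k arbitrary: F rule: less_induct)
  case (less k)
  then have "pick F \<noteq> None"
    using prune by (cases k) (auto split: option.splits)
  then obtain C where "pick F = Some C"
    by blast
  then have C: "C \<in> set Cs" "avoids (set F) C"
    using pick by (auto simp: find_Some_iff)
  \<comment> \<open>With no budget left, \<open>F\<close> already exhausts \<open>A\<close>.\<close>
  have "avoids A C" if "k = 0"
    using less.prems that C card_seteq[of A "set F"] by simp
  moreover have ?case if bad: "\<not> avoids A C" and k: "k = Suc k'" for k'
  proof -
    from bad obtain x y where xy: "(x, y) \<in> set C" "x \<in> A" "y \<in> A"
      by (auto simp: avoids_def)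
    have step: "if x \<in> set F then search prune pick k' (y # F)
      else if y \<in> set F then search prune pick k' (x # F)
      else if k' = 0 then True else search prune pick (k' - 1) (x # y # F)"
      using less.prems(1) prune[OF less.prems(2)] \<open>pick F = Some C\<close> xy(1) by (auto simp: k)
    have "x \<noteq> y" "\<not> (x \<in> set F \<and> y \<in> set F)"
      using irrefl C xy by (fastforce simp: avoids_def)+
    then consider "x \<in> set F" "y \<notin> set F" | "x \<notin> set F" "y \<in> set F" | "x \<notin> set F" "y \<notin> set F"
      by blast
    then show ?thesis
    proof cases
      case 1
      then show ?thesis
        using less.IH[of k' "y # F"] less.prems xy step k by simp
    next
      case 2
      then show ?thesis
        using less.IH[of k' "x # F"] less.prems xy step k by simp
    next
      case 3
      have "card (set (x # y # F)) \<le> card A"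
        using less.prems xy by (intro card_mono) auto
      \<comment> \<open>Two new elements do not fit into a budget of one; this justifies the answer
        \<open>True\<close> in that branch of \<open>search\<close>.\<close>
      then have "k' \<noteq> 0"
        using less.prems(4) 3 \<open>x \<noteq> y\<close> k by simp
      then show ?thesis
        using less.IH[of "k' - 1" "x # y # F"] less.prems xy step k 3 \<open>x \<noteq> y\<close> by simp
    qed
  qed
  ultimately show ?case
    using C(1) by (cases k) auto
qed

section \<open>Candidate permutations on three, four and five points\<close>

text \<open>
  The conflicts of \<open>(a b)\<close>, \<open>(a b)(c d)\<close> and \<open>(a b c d)\<close>, where \<open>c\<close> (in \<open>swap3\<close>) and \<open>e\<close> are
  fixed. On four vertices the 4-cycles cannot be dispensed with.
\<close>

definition swap3 :: "'a \<Rightarrow> 'a \<Rightarrow> 'a \<Rightarrow> (('a \<times> 'a) \<times> ('a \<times> 'a)) list" where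
  "swap3 a b c = [((a, b), (b, a)), ((a, c), (b, c)), ((c, a), (c, b))]"

definition swap4 :: "'a \<Rightarrow> 'a \<Rightarrow> 'a \<Rightarrow> 'a \<Rightarrow> (('a \<times> 'a) \<times> ('a \<times> 'a)) list" where
  "swap4 a b c d =
    [((a, b), (b, a)), ((c, d), (d, c)),
     ((a, c), (b, d)), ((a, d), (b, c)), ((c, a), (d, b)), ((c, b), (d, a))]"

definition cycle4 :: "'a \<Rightarrow> 'a \<Rightarrow> 'a \<Rightarrow> 'a \<Rightarrow> (('a \<times> 'a) \<times> ('a \<times> 'a)) list" where
  "cycle4 a b c d =
    [((a, b), (b, c)), ((b, c), (c, d)), ((c, d), (d, a)), ((d, a), (a, b)),
     ((a, c), (b, d)), ((b, d), (c, a)), ((c, a), (d, b)), ((d, b), (a, c)),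
     ((b, a), (c, b)), ((c, b), (d, c)), ((d, c), (a, d)), ((a, d), (b, a))]"

definition swap5 :: "'a \<Rightarrow> 'a \<Rightarrow> 'a \<Rightarrow> 'a \<Rightarrow> 'a \<Rightarrow> (('a \<times> 'a) \<times> ('a \<times> 'a)) list" where
  "swap5 a b c d e =
    [((a, b), (b, a)), ((c, d), (d, c)),
     ((a, c), (b, d)), ((a, d), (b, c)), ((c, a), (d, b)), ((c, b), (d, a)),
     ((a, e), (b, e)), ((e, a), (e, b)), ((c, e), (d, e)), ((e, c), (e, d))]"

definition conflicts3 :: "((nat \<times> nat) \<times> (nat \<times> nat)) list list" where
  "conflicts3 = [swap3 0 1 2, swap3 0 2 1, swap3 1 2 0]"

text \<open>A permutation and its inverse have the same conflicts up to the order of the pairs, so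
  one 4-cycle stands for each inverse pair.\<close>

definition conflicts4 :: "((nat \<times> nat) \<times> (nat \<times> nat)) list list" where
  "conflicts4 =
    [swap4 0 1 2 3, swap4 0 2 1 3, swap4 0 3 1 2, cycle4 0 1 2 3, cycle4 0 1 3 2, cycle4 0 2 1 3]"

text \<open>Each row has one fixed point and runs through the three pairings of the other
  four.\<close>

definition conflicts5 :: "((nat \<times> nat) \<times> (nat \<times> nat)) list list" where
  "conflicts5 =
    [swap5 0 1 2 3 4, swap5 0 2 1 3 4, swap5 0 3 1 2 4,
     swap5 0 1 2 4 3, swap5 0 2 1 4 3, swap5 0 4 1 2 3,
     swap5 0 1 3 4 2, swap5 0 3 1 4 2, swap5 0 4 1 3 2,
     swap5 0 2 3 4 1, swap5 0 3 2 4 1, swap5 0 4 2 3 1,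
     swap5 1 2 3 4 0, swap5 1 3 2 4 0, swap5 1 4 2 3 0]"

lemma irrefl_conflicts3: "\<forall>C \<in> set conflicts3. \<forall>(x, y) \<in> set C. x \<noteq> y"
  by code_simp

lemma irrefl_conflicts4: "\<forall>C \<in> set conflicts4. \<forall>(x, y) \<in> set C. x \<noteq> y"
  by code_simp

lemma irrefl_conflicts5: "\<forall>C \<in> set conflicts5. \<forall>(x, y) \<in> set C. x \<noteq> y"
  by code_simp

definition "pick3 F = find (avoids (set F)) conflicts3"
definition "pick4 F = find (avoids (set F)) conflicts4"
definition "pick5 F = find (avoids (set F)) conflicts5"

text \<open>
  Nested conditionals keep the simplifier from traversing the list literals again at each step.
\<close>

lemmas pick_code [code] =
  pick3_def [unfolded conflicts3_def find.simps]
  pick4_def [unfolded conflicts4_def find.simps]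
  pick5_def [unfolded conflicts5_def find.simps]

definition has_disjoint_pair :: "('a \<times> 'a) set \<Rightarrow> bool" where
  "has_disjoint_pair A \<longleftrightarrow> (\<exists>(u, v) \<in> A. \<exists>(x, y) \<in> A. distinct [u, v, x, y])"

text \<open>The budgets for three and four vertices are \<open>2n - 4\<close>, that is, two and
  four.\<close>

lemma search3: "search (\<lambda>_. False) pick3 2 []"
  by code_simp

lemma search4: "search (\<lambda>_. False) pick4 4 []"
  by code_simp

text \<open>
  Labelling the ends of two disjoint arcs first cuts the search on five vertices to about a tenth.
\<close>

lemma search5_disjoint: "search (\<lambda>_. False) pick5 4 [(0, 2), (1, 3)]"
  by code_simp

text \<open>This covers digraphs without two disjoint arcs, so any branch that collects such a pair
  is cut. The other search spends two of its six arcs on the pair it starts from.\<close>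

lemma search5_intersecting: "search (has_disjoint_pair \<circ> set) pick5 6 []"
  by code_simp

section \<open>Transfer from numbered points to arbitrary vertices\<close>

text \<open>Numbering the vertices lets one computation on natural numbers serve every vertex
  type.\<close>

definition index_arcs :: "'a list \<Rightarrow> 'a pair_pre_digraph \<Rightarrow> (nat \<times> nat) set" where
  "index_arcs xs D = {(i, j). i < length xs \<and> j < length xs \<and> (xs ! i, xs ! j) \<in> parcs D}"

lemma finite_index_arcs: "finite (index_arcs xs D)"
  by (rule finite_subset[of _ "{..<length xs} \<times> {..<length xs}"]) (auto simp: index_arcs_def)

lemma card_index_arcs_le:
  assumes "distinct xs" "finite (parcs D)"
  shows "card (index_arcs xs D) \<le> card (parcs D)"
proof (rule card_inj_on_le)
  show "inj_on (map_prod ((!) xs) ((!) xs)) (index_arcs xs D)"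
    using assms(1) by (auto simp: inj_on_def index_arcs_def nth_eq_iff_index_eq)
  show "map_prod ((!) xs) ((!) xs) ` index_arcs xs D \<subseteq> parcs D"
    by (auto simp: index_arcs_def)
qed (use assms in simp)

lemma search_index_arcs:
  assumes "search prune pick k F" "set F \<subseteq> index_arcs xs D"
    and "distinct xs" "finite (parcs D)" "card (parcs D) \<le> card (set F) + k"
    and "\<And>F. pick F = find (avoids (set F)) Cs"
    and "\<And>F. set F \<subseteq> index_arcs xs D \<Longrightarrow> \<not> prune F"
    and "\<forall>C \<in> set Cs. \<forall>(x, y) \<in> set C. x \<noteq> y"
  shows "\<exists>C \<in> set Cs. avoids (index_arcs xs D) C"
  using assms card_index_arcs_le[OF assms(3,4)] finite_index_arcs
  by (intro search_sound[of prune pick k F]) auto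

lemma completable_swap3:
  assumes D: "pair_digraph D" and V: "pverts D = {a, b, c}" and dist: "distinct [a, b, c]"
    and free: "avoids (parcs D) (swap3 a b c)"
  shows "completable D"
proof (rule completableI[OF D, where p = "id(a := b, b := a)"])
  \<comment> \<open>The reversed list supplies each inequality in the opposite orientation as
    well.\<close>
  have "distinct [c, b, a]"
    using dist by auto
  fix u v assume uv: "(u, v) \<in> parcs D"
  then have "u \<in> {a, b, c}" "v \<in> {a, b, c}" "u \<noteq> v"
    using D V by (auto simp: pair_digraph_iff)
  then show "((id(a := b, b := a)) u, (id(a := b, b := a)) v) \<notin> parcs D"
    by (elim insertE emptyE) (use uv free dist \<open>distinct [c, b, a]\<close> in \<open>simp_all add: avoids_def swap3_def\<close>)
qed (use V dist in auto)

lemma completable_swap4: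
  assumes D: "pair_digraph D" and V: "pverts D = {a, b, c, d}" and dist: "distinct [a, b, c, d]"
    and free: "avoids (parcs D) (swap4 a b c d)"
  shows "completable D"
proof (rule completableI[OF D, where p = "id(a := b, b := a, c := d, d := c)"])
  have "distinct [d, c, b, a]"
    using dist by auto
  fix u v assume uv: "(u, v) \<in> parcs D"
  then have "u \<in> {a, b, c, d}" "v \<in> {a, b, c, d}" "u \<noteq> v"
    using D V by (auto simp: pair_digraph_iff)
  then show "((id(a := b, b := a, c := d, d := c)) u, (id(a := b, b := a, c := d, d := c)) v) \<notin> parcs D"
    by (elim insertE emptyE) (use uv free dist \<open>distinct [d, c, b, a]\<close> in \<open>simp_all add: avoids_def swap4_def\<close>)
qed (use V dist in auto)

text \<open>The twelve ordered pairs form three orbits of length four, one for each row of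
  \<open>cycle4\<close>.\<close>

lemma completable_cycle4:
  assumes D: "pair_digraph D" and V: "pverts D = {a, b, c, d}" and dist: "distinct [a, b, c, d]"
    and free: "avoids (parcs D) (cycle4 a b c d)"
  shows "completable D"
proof (rule completableI[OF D, where p = "id(a := b, b := c, c := d, d := a)"])
  have "distinct [d, c, b, a]"
    using dist by auto
  fix u v assume uv: "(u, v) \<in> parcs D"
  then have "u \<in> {a, b, c, d}" "v \<in> {a, b, c, d}" "u \<noteq> v"
    using D V by (auto simp: pair_digraph_iff)
  then show "((id(a := b, b := c, c := d, d := a)) u, (id(a := b, b := c, c := d, d := a)) v) \<notin> parcs D"
    by (elim insertE emptyE) (use uv free dist \<open>distinct [d, c, b, a]\<close> in \<open>simp_all add: avoids_def cycle4_def\<close>)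
qed (use V dist in auto)

text \<open>The permutation is an involution with \<open>e\<close> as its only fixed point, so
  listing each two-element orbit of pairs once covers all conflicts.\<close>

lemma completable_swap5:
  assumes D: "pair_digraph D" and V: "pverts D = {a, b, c, d, e}" and dist: "distinct [a, b, c, d, e]"
    and free: "avoids (parcs D) (swap5 a b c d e)"
  shows "completable D"
proof (rule completableI[OF D, where p = "id(a := b, b := a, c := d, d := c)"])
  have "distinct [e, d, c, b, a]"
    using dist by auto
  fix u v assume uv: "(u, v) \<in> parcs D"
  then have "u \<in> {a, b, c, d, e}" "v \<in> {a, b, c, d, e}" "u \<noteq> v"
    using D V by (auto simp: pair_digraph_iff)
  then show "((id(a := b, b := a, c := d, d := c)) u, (id(a := b, b := a, c := d, d := c)) v) \<notin> parcs D"
    by (elim insertE emptyE) (use uv free dist \<open>distinct [e, d, c, b, a]\<close> in \<open>simp_all add: avoids_def swap5_def\<close>)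
qed (use V dist in auto)

lemma set_eq_nth_image:
  assumes "distinct is" "set is \<subseteq> {..<length xs}" "length is = length xs"
  shows "set xs = (!) xs ` set is"
proof -
  have "set is = {..<length xs}"
    using assms by (intro card_subset_eq) (auto simp: distinct_card)
  then show ?thesis
    by (auto simp: set_conv_nth)
qed

lemma completable_conflicts3:
  assumes D: "pair_digraph D" and V: "pverts D = set xs" and xs: "distinct xs" "length xs = 3"
    and "C \<in> set conflicts3" "avoids (index_arcs xs D) C"
  shows "completable D"
proof -
  have swap3: "completable D"
    if "avoids (index_arcs xs D) (swap3 a b c)"
      "distinct [a, b, c]" "set [a, b, c] \<subseteq> {..<3}" for a b c
    using that xs set_eq_nth_image[of "[a, b, c]" xs]
    by (intro completable_swap3[OF D, of "xs ! a" "xs ! b" "xs ! c"])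
      (simp_all add: V nth_eq_iff_index_eq avoids_def swap3_def index_arcs_def)
  show ?thesis
    using assms(5,6) by (auto simp: conflicts3_def dest!: swap3)
qed

lemma completable_conflicts4:
  assumes D: "pair_digraph D" and V: "pverts D = set xs" and xs: "distinct xs" "length xs = 4"
    and "C \<in> set conflicts4" "avoids (index_arcs xs D) C"
  shows "completable D"
proof -
  have swap4: "completable D"
    if "avoids (index_arcs xs D) (swap4 a b c d)"
      "distinct [a, b, c, d]" "set [a, b, c, d] \<subseteq> {..<4}" for a b c d
    using that xs set_eq_nth_image[of "[a, b, c, d]" xs]
    by (intro completable_swap4[OF D, of "xs ! a" "xs ! b" "xs ! c" "xs ! d"])
      (simp_all add: V nth_eq_iff_index_eq avoids_def swap4_def index_arcs_def)
  have cycle4: "completable D"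
    if "avoids (index_arcs xs D) (cycle4 a b c d)"
      "distinct [a, b, c, d]" "set [a, b, c, d] \<subseteq> {..<4}" for a b c d
    using that xs set_eq_nth_image[of "[a, b, c, d]" xs]
    by (intro completable_cycle4[OF D, of "xs ! a" "xs ! b" "xs ! c" "xs ! d"])
      (simp_all add: V nth_eq_iff_index_eq avoids_def cycle4_def index_arcs_def)
  show ?thesis
    using assms(5,6) by (auto simp: conflicts4_def dest!: swap4 cycle4)
qed

lemma completable_conflicts5:
  assumes D: "pair_digraph D" and V: "pverts D = set xs" and xs: "distinct xs" "length xs = 5"
    and "C \<in> set conflicts5" "avoids (index_arcs xs D) C"
  shows "completable D"
proof -
  have swap5: "completable D"
    if "avoids (index_arcs xs D) (swap5 a b c d e)"
      "distinct [a, b, c, d, e]" "set [a, b, c, d, e] \<subseteq> {..<5}" for a b c d e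
    using that xs set_eq_nth_image[of "[a, b, c, d, e]" xs]
    by (intro completable_swap5[OF D, of "xs ! a" "xs ! b" "xs ! c" "xs ! d" "xs ! e"])
      (simp_all add: V nth_eq_iff_index_eq avoids_def swap5_def index_arcs_def)
  show ?thesis
    using assms(5,6) by (auto simp: conflicts5_def dest!: swap5)
qed

section \<open>Orders two to five\<close>

lemma completable_order2:
  assumes "pair_digraph D" "card (pverts D) = 2" "parcs D = {}"
  shows "completable D"
proof -
  obtain a b where "pverts D = {a, b}" "a \<noteq> b"
    using assms(2) by (auto simp: card_2_iff)
  then show ?thesis
    using assms by (intro completableI[where p = "id(a := b, b := a)"]) auto
qed

lemma completable_order3:
  assumes D: "pair_digraph D" and "card (pverts D) = 3" "card (parcs D) \<le> 2"
  shows "completable D"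
proof -
  interpret pair_digraph D by fact
  obtain xs where xs: "set xs = pverts D" "distinct xs" "length xs = 3"
    using finite_distinct_list[OF pair_finite_verts] distinct_card assms(2) by metis
  have "\<exists>C \<in> set conflicts3. avoids (index_arcs xs D) C"
    using assms(3)
    by (intro search_index_arcs[OF search3 _ xs(2) pair_finite_arcs _ pick3_def _ irrefl_conflicts3]) auto
  then show ?thesis
    using completable_conflicts3[OF D] xs by blast
qed

lemma completable_order4:
  assumes D: "pair_digraph D" and "card (pverts D) = 4" "card (parcs D) \<le> 4"
  shows "completable D"
proof -
  interpret pair_digraph D by fact
  obtain xs where xs: "set xs = pverts D" "distinct xs" "length xs = 4"
    using finite_distinct_list[OF pair_finite_verts] distinct_card assms(2) by metis
  have "\<exists>C \<in> set conflicts4. avoids (index_arcs xs D) C"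
    using assms(3)
    by (intro search_index_arcs[OF search4 _ xs(2) pair_finite_arcs _ pick4_def _ irrefl_conflicts4]) auto
  then show ?thesis
    using completable_conflicts4[OF D] xs by blast
qed

lemma completable_order5:
  assumes D: "pair_digraph D" and card: "card (pverts D) = 5" "card (parcs D) \<le> 6"
  shows "completable D"
proof -
  interpret pair_digraph D by fact
  show ?thesis
  proof (cases "has_disjoint_pair (parcs D)")
    case True
    then obtain u v x y where uv: "(u, v) \<in> parcs D" and xy: "(x, y) \<in> parcs D"
      and dist: "distinct [u, v, x, y]"
      by (auto simp: has_disjoint_pair_def)
    have sub: "{u, v, x, y} \<subseteq> pverts D"
      using uv xy in_arcsD1 in_arcsD2 by blast
    then have "card (pverts D - {u, v, x, y}) = 1"
      using card(1) dist by (simp add: card_Diff_subset)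
    then obtain w where w: "pverts D - {u, v, x, y} = {w}"
      by (auto simp: card_1_singleton_iff)
    \<comment> \<open>This order turns the arcs \<open>(u, v)\<close> and \<open>(x, y)\<close> into
      \<open>(0, 2)\<close> and \<open>(1, 3)\<close>, where the search starts.\<close>
    define xs where "xs = [u, x, v, y, w]"
    have xs: "set xs = pverts D" "distinct xs" "length xs = 5"
      using sub w dist by (auto simp: xs_def)
    have "set [(0, 2), (1, 3)] \<subseteq> index_arcs xs D"
      using uv xy by (simp add: index_arcs_def xs_def)
    then have "\<exists>C \<in> set conflicts5. avoids (index_arcs xs D) C"
      using card(2)
      by (intro search_index_arcs[OF search5_disjoint _ xs(2) pair_finite_arcs _ pick5_def _ irrefl_conflicts5])
        auto
    then show ?thesis
      using completable_conflicts5[OF D] xs by blast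
  next
    case False
    obtain xs where xs: "set xs = pverts D" "distinct xs" "length xs = 5"
      using finite_distinct_list[OF pair_finite_verts] distinct_card card(1) by metis
    \<comment> \<open>Distinct indices name distinct vertices, so disjoint index arcs would give
      disjoint arcs of \<open>D\<close>.\<close>
    have "\<not> (has_disjoint_pair \<circ> set) F" if "set F \<subseteq> index_arcs xs D" for F
    proof
      assume "(has_disjoint_pair \<circ> set) F"
      then obtain i j k l where "(i, j) \<in> set F" "(k, l) \<in> set F" and ijkl: "distinct [i, j, k, l]"
        by (auto simp: has_disjoint_pair_def)
      then have "(i, j) \<in> index_arcs xs D" "(k, l) \<in> index_arcs xs D"
        using that by auto
      then have "(xs ! i, xs ! j) \<in> parcs D" "(xs ! k, xs ! l) \<in> parcs D"
        "distinct [xs ! i, xs ! j, xs ! k, xs ! l]"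
        using ijkl xs(2) by (auto simp: index_arcs_def nth_eq_iff_index_eq)
      then have "has_disjoint_pair (parcs D)"
        unfolding has_disjoint_pair_def by blast
      with False show False ..
    qed
    then have "\<exists>C \<in> set conflicts5. avoids (index_arcs xs D) C"
      using card(2)
      by (intro search_index_arcs[OF search5_intersecting _ xs(2) pair_finite_arcs _ pick5_def _ irrefl_conflicts5])
        auto
    then show ?thesis
      using completable_conflicts5[OF D] xs by blast
  qed
qed

lemma completable_order_le_5:
  assumes D: "pair_digraph D" and "card (pverts D) \<le> 5"
    and "int (card (parcs D)) \<le> 2 * int (card (pverts D)) - 4"
  shows "completable D"
proof -
  interpret pair_digraph D by fact
  \<comment> \<open>For orders zero and one the bound is negative, so no digraph satisfies
    it.\<close>
  consider "card (pverts D) = 2" | "card (pverts D) = 3" | "card (pverts D) = 4" | "card (pverts D) = 5"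
    using assms(2,3) by linarith
  then show ?thesis
  proof cases
    case 1
    then have "parcs D = {}"
      using assms(3) pair_finite_arcs by simp
    with D 1 show ?thesis
      by (rule completable_order2)
  next
    case 2
    with D assms(3) show ?thesis
      by (intro completable_order3) auto
  next
    case 3
    with D assms(3) show ?thesis
      by (intro completable_order4) auto
  next
    case 4
    with D assms(3) show ?thesis
      by (intro completable_order5) auto
  qed
qed

theorem corollary4p1:
  shows "wozniak_counterexample D0 \<and>
    zhang_wei_counterexample D0 \<and>
    (\<forall>n\<le>5. \<forall>D :: 'a pair_pre_digraph.
      pair_digraph D \<and> card (pverts D) = n \<and> int (card (parcs D)) \<le> 2 * int n - 4
        \<longrightarrow> completable D) \<and>
    \<not> (\<forall>D :: nat pair_pre_digraph.
      pair_digraph D \<and> card (pverts D) = 6 \<and> int (card (parcs D)) \<le> 2 * int 6 - 4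
        \<longrightarrow> completable D)"
proof -
  \<comment> \<open>Eight equals \<open>2 * 6 - 4\<close>, so \<open>D0\<close> meets both arc
    bounds.\<close>
  have "pair_digraph D0" "card (pverts D0) = 6" "card (parcs D0) = 8"
    by (simp_all add: pair_digraph_iff D0_def)
  then show ?thesis
    using not_completable_D0 completable_order_le_5
    by (auto simp: wozniak_counterexample_def zhang_wei_counterexample_def)
qed

end
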